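(* Let $n\ge 2$. For every domain $D\subsetneq\mathbb{R}^n$ and all $x,y\in D$, $$u_D(x,y)\le 3\,j_D(x,y),$$ and the inequality is sharp, i.e. the constant $3$ cannot be replaced by any smaller constant valid for all domains $D\subsetneq\mathbb{R}^n$ and all $x,y\in D$.
   Context: A domain is a nonempty open connected set. For a domain $D\subsetneq\mathbb{R}^n$ and $x\in D$, $d(x)$ denotes the Euclidean distance from $x$ to $\partial D$. The Gromov hyperbolic metric $u_D$ is $$u_D(x,y)=2\log\frac{|x-y|+\max\{d(x),d(y)\}}{\sqrt{d(x)\,d(y)}},\qquad x,y\in D,$$ and the distance ratio metric $j_D$ is $$j_D(x,y)=\log\left(1+\frac{|x-y|}{\min\{d(x),d(y)\}}\right),\qquad x,y\in D.$$ *)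

theory Defs
  imports "HOL-Analysis.Analysis"
begin

definition euclidean_domain :: "'a::euclidean_space set \<Rightarrow> bool" where
  "euclidean_domain D \<longleftrightarrow> D \<noteq> {} \<and> open D \<and> connected D"

(* infdist x {} = 0, but the frontier of a nonempty D \<noteq> UNIV is never empty. *)
definition bdist :: "'a::euclidean_space set \<Rightarrow> 'a \<Rightarrow> real" where
  "bdist D x = infdist x (frontier D)"

definition gromov_metric :: "'a::euclidean_space set \<Rightarrow> 'a \<Rightarrow> 'a \<Rightarrow> real" where
  "gromov_metric D x y =
     2 * ln ((norm (x - y) + max (bdist D x) (bdist D y)) / sqrt (bdist D x * bdist D y))"

definition distance_ratio_metric :: "'a::euclidean_space set \<Rightarrow> 'a \<Rightarrow> 'a \<Rightarrow> real" where
  "distance_ratio_metric D x y = ln (1 + norm (x - y) / min (bdist D x) (bdist D y))"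

end

theory Submission
  imports Defs
begin

text \<open>
  Write \<open>a \<le> b\<close> for the two boundary distances and \<open>t\<close> for the distance of the points.  The
  distance to the boundary is 1-Lipschitz, so \<open>b \<le> a + t\<close>, and exponentiating turns the
  inequality into \<open>(t + b)\<^sup>2 / (a b) \<le> (1 + t / a)\<^sup>3\<close>.  For fixed \<open>a\<close> and \<open>t\<close> the left-hand
  side is convex in \<open>b\<close>, and at both ends \<open>b = a\<close> and \<open>b = a + t\<close> of the range of \<open>b\<close> the
  inequality is immediate; \<open>cleared_metric_inequality\<close> proves it on the whole range at once by
  exhibiting the difference of the two sides as a sum of nonnegative terms.

  The constant 3 is approached at small distances where the boundary distance grows at full speed,
  \<open>b = a + t\<close>.  There, with \<open>a = 1\<close>, the two metrics are \<open>2 ln (1 + 2t) - ln (1 + t) \<approx> 3t\<close> and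
  \<open>ln (1 + t) \<approx> t\<close> as \<open>t\<close> tends to 0.  The punctured space realizes this along a ray from the
  puncture, and it is connected because the dimension is at least 2.
\<close>

text \<open>
  With \<open>b = a + s\<close> and \<open>t = s + r\<close>, the constraints become \<open>s, r \<ge> 0\<close>, and the difference of the
  two sides is a polynomial in \<open>a, s, r, t\<close> with nonnegative coefficients.
\<close>

lemma cleared_metric_inequality:
  fixes a b t :: real
  assumes "0 \<le> a" "a \<le> b" "b \<le> a + t"
  shows "a\<^sup>2 * (t + b)\<^sup>2 \<le> b * (a + t) ^ 3"
proof -
  define s r where "s = b - a" and "r = a + t - b"
  have eqs: "b = a + s" "t = s + r" and nonneg: "0 \<le> s" "0 \<le> r" "0 \<le> t"
    using assms by (auto simp: s_def r_def)
  have "b * (a + t) ^ 3 - a\<^sup>2 * (t + b)\<^sup>2 =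
      a ^ 3 * r + a\<^sup>2 * (2 * t\<^sup>2 + s * r) + a * t ^ 3 + 3 * a * s * t\<^sup>2 + s * t ^ 3"
    unfolding eqs by algebra
  also have "\<dots> \<ge> 0"
    using assms(1) nonneg by (intro add_nonneg_nonneg mult_nonneg_nonneg zero_le_power) auto
  finally show ?thesis by simp
qed

lemma log_metric_inequality:
  fixes a b t :: real
  assumes "0 < a" "a \<le> b" "b \<le> a + t" "0 \<le> t"
  shows "2 * ln ((t + b) / sqrt (a * b)) \<le> 3 * ln (1 + t / a)"
proof -
  have b: "0 < b" using assms by simp
  have "((t + b) / sqrt (a * b))\<^sup>2 = (t + b)\<^sup>2 / (a * b)"
    using assms b by (simp add: power_divide)
  also have "\<dots> \<le> ((a + t) / a) ^ 3"
  proof -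
    have "a * (a\<^sup>2 * (t + b)\<^sup>2) \<le> a * (b * (a + t) ^ 3)"
      using cleared_metric_inequality[of a b t] assms by (intro mult_left_mono) auto
    then show ?thesis
      using assms b by (simp add: power_divide field_simps power2_eq_square power3_eq_cube)
  qed
  also have "(a + t) / a = 1 + t / a"
    using assms by (simp add: field_simps)
  finally have le: "((t + b) / sqrt (a * b))\<^sup>2 \<le> (1 + t / a) ^ 3" .
  have pos: "0 < (t + b) / sqrt (a * b)" "0 < 1 + t / a"
    using assms b by (auto intro!: divide_pos_pos add_pos_nonneg)
  have "ln (((t + b) / sqrt (a * b))\<^sup>2) \<le> ln ((1 + t / a) ^ 3)"
    using le pos by (intro ln_mono) auto
  then show ?thesis
    using pos by (simp add: ln_realpow)
qed

lemma bdist_pos: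
  fixes D :: "'a::euclidean_space set"
  assumes "open D" "D \<noteq> UNIV" "x \<in> D"
  shows "0 < bdist D x"
proof -
  have "frontier D \<noteq> {}"
    using assms by (auto simp: frontier_eq_empty)
  moreover have "x \<notin> frontier D"
    using assms by (simp add: frontier_def interior_open)
  ultimately show ?thesis
    unfolding bdist_def by (intro infdist_pos_not_in_closed) auto
qed

lemma bdist_lipschitz:
  fixes D :: "'a::euclidean_space set"
  shows "bdist D y \<le> bdist D x + norm (x - y)"
  using infdist_triangle[of y "frontier D" x] by (simp add: bdist_def dist_norm norm_minus_commute)

lemma gromov_metric_le_3_distance_ratio_metric:
  fixes D :: "'a::euclidean_space set"
  assumes D: "open D" "D \<noteq> UNIV" and "x \<in> D" "y \<in> D"
  shows "gromov_metric D x y \<le> 3 * distance_ratio_metric D x y"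
proof -
  let ?a = "min (bdist D x) (bdist D y)" and ?b = "max (bdist D x) (bdist D y)"
  have "?b \<le> ?a + norm (x - y)"
    using bdist_lipschitz[of D y x] bdist_lipschitz[of D x y]
    by (simp add: norm_minus_commute min_def max_def)
  moreover have "0 < ?a"
    using assms by (simp add: bdist_pos)
  ultimately have "2 * ln ((norm (x - y) + ?b) / sqrt (?a * ?b)) \<le> 3 * ln (1 + norm (x - y) / ?a)"
    by (intro log_metric_inequality) auto
  moreover have "?a * ?b = bdist D x * bdist D y"
    by (simp add: min_def max_def)
  ultimately show ?thesis
    by (simp add: gromov_metric_def distance_ratio_metric_def)
qed

lemma bdist_punctured_space:
  fixes x :: "'a::euclidean_space"
  shows "bdist (- {0}) x = norm x"
proof -
  have "frontier (- {0 :: 'a}) = {0}"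
    unfolding frontier_complement by (simp add: frontier_def)
  then show ?thesis
    by (simp add: bdist_def)
qed

lemma euclidean_domain_punctured_space:
  assumes "2 \<le> DIM('a::euclidean_space)"
  shows "euclidean_domain (- {0 :: 'a})"
  using nonempty_Basis nonzero_Basis connected_punctured_universe[OF assms, of 0]
  by (auto simp: euclidean_domain_def open_Compl)

text \<open>
  On a ray from the puncture the distance of two points is exactly the difference of their boundary
  distances, the extreme case \<open>b = a + t\<close> of the Lipschitz bound.
\<close>

lemma metrics_on_ray_of_punctured_space:
  fixes e :: "'a::euclidean_space"
  assumes e: "norm e = 1" and t: "0 < t"
  shows "gromov_metric (- {0}) e ((1 + t) *\<^sub>R e) = 2 * ln (1 + 2 * t) - ln (1 + t)"
    and "distance_ratio_metric (- {0}) e ((1 + t) *\<^sub>R e) = ln (1 + t)"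
proof -
  have "e - (1 + t) *\<^sub>R e = (- t) *\<^sub>R e"
    by (simp add: algebra_simps)
  then have dist: "norm (e - (1 + t) *\<^sub>R e) = t"
    using e t by simp
  have bd: "bdist (- {0}) e = 1" "bdist (- {0}) ((1 + t) *\<^sub>R e) = 1 + t"
    using e t by (simp_all add: bdist_punctured_space)
  show "gromov_metric (- {0}) e ((1 + t) *\<^sub>R e) = 2 * ln (1 + 2 * t) - ln (1 + t)"
    using t unfolding gromov_metric_def bd dist by (simp add: ln_div ln_sqrt)
  show "distance_ratio_metric (- {0}) e ((1 + t) *\<^sub>R e) = ln (1 + t)"
    using t unfolding distance_ratio_metric_def bd dist by simp
qed

text \<open>
  After \<open>ln (1 + t)\<close> is moved to the left, the two sides are \<open>(c + 1) t\<close> and \<open>4t\<close> up to terms of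
  second order in \<open>t\<close>, so the inequality holds for small \<open>t\<close> because \<open>c + 1 < 4\<close>.  The
  bounds \<open>u / (1 + u) \<le> ln (1 + u) \<le> u\<close> make this quantitative and give an explicit witness.
\<close>

lemma ln_ratio_exceeds_constant_below_3:
  fixes c :: real
  assumes c: "c < 3"
  obtains t where "0 < t" "c * ln (1 + t) < 2 * ln (1 + 2 * t) - ln (1 + t)"
proof -
  \<comment> \<open>The bounds leave \<open>(c + 1) (1 + 2t) < 4\<close> to be satisfied.  With \<open>d = 3 - c\<close> this reads
    \<open>(4 - d) (1 + 2t) < 4\<close>, which holds for \<open>t = d / 8\<close>.\<close>
  define t where "t = (3 - c) / 8"
  have t: "0 < t" and c_eq: "c = 3 - 8 * t"
    using c by (simp_all add: t_def field_simps)
  have "(c + 1) * ln (1 + t) < 2 * ln (1 + 2 * t)"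
  proof (cases "c + 1 \<le> 0")
    case True
    then have "(c + 1) * ln (1 + t) \<le> 0"
      using t by (intro mult_nonpos_nonneg) auto
    also have "0 < 2 * ln (1 + 2 * t)"
      using t by simp
    finally show ?thesis .
  next
    case False
    then have "(c + 1) * ln (1 + t) \<le> (c + 1) * t"
      using t by (intro mult_left_mono ln_add_one_self_le_self) auto
    also have "\<dots> < 4 * t / (1 + 2 * t)"
      using t by (simp add: c_eq field_simps)
    also have "4 * t / (1 + 2 * t) \<le> 2 * ln (1 + 2 * t)"
    proof -
      have "ln (inverse (1 + 2 * t)) \<le> inverse (1 + 2 * t) - 1"
        using t by (intro ln_le_minus_one) auto
      then have "1 - inverse (1 + 2 * t) \<le> ln (1 + 2 * t)"
        using t by (simp add: ln_inverse)
      then show ?thesis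
        using t by (simp add: field_simps)
    qed
    finally show ?thesis .
  qed
  then have "c * ln (1 + t) < 2 * ln (1 + 2 * t) - ln (1 + t)"
    by (simp add: algebra_simps)
  with t show ?thesis by (rule that)
qed

lemma distance_ratio_constant_below_3_fails:
  fixes c :: real
  assumes dim: "2 \<le> DIM('a::euclidean_space)" and c: "c < 3"
  shows "\<exists>D :: 'a set. euclidean_domain D \<and> D \<noteq> UNIV \<and>
    (\<exists>x\<in>D. \<exists>y\<in>D. c * distance_ratio_metric D x y < gromov_metric D x y)"
proof -
  obtain t where t: "0 < t" "c * ln (1 + t) < 2 * ln (1 + 2 * t) - ln (1 + t)"
    using ln_ratio_exceeds_constant_below_3[OF c] .
  obtain e :: 'a where e: "norm e = 1"
    using nonempty_Basis norm_Basis by blast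
  let ?D = "- {0 :: 'a}" and ?y = "(1 + t) *\<^sub>R e"
  have "e \<in> ?D" "?y \<in> ?D"
    using e t(1) by auto
  moreover have "c * distance_ratio_metric ?D e ?y < gromov_metric ?D e ?y"
    using t(2) by (simp add: metrics_on_ray_of_punctured_space[OF e t(1)])
  moreover have "?D \<noteq> UNIV"
    by auto
  ultimately show ?thesis
    using euclidean_domain_punctured_space[OF dim] by blast
qed

theorem corollary4p4:
  assumes "CARD('n::finite) \<ge> 2"
  shows "(\<forall>D :: (real ^ 'n) set. euclidean_domain D \<and> D \<noteq> UNIV \<longrightarrow>
            (\<forall>x\<in>D. \<forall>y\<in>D. gromov_metric D x y \<le> 3 * distance_ratio_metric D x y)) \<and>
         \<not> (\<exists>c::real. c < 3 \<and>
            (\<forall>D :: (real ^ 'n) set. euclidean_domain D \<and> D \<noteq> UNIV \<longrightarrow>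
              (\<forall>x\<in>D. \<forall>y\<in>D. gromov_metric D x y \<le> c * distance_ratio_metric D x y)))"
proof (intro conjI)
  show "\<forall>D :: (real ^ 'n) set. euclidean_domain D \<and> D \<noteq> UNIV \<longrightarrow>
      (\<forall>x\<in>D. \<forall>y\<in>D. gromov_metric D x y \<le> 3 * distance_ratio_metric D x y)"
    by (auto simp: euclidean_domain_def intro: gromov_metric_le_3_distance_ratio_metric)
  have "2 \<le> DIM(real ^ 'n)"
    using assms by simp
  then show "\<not> (\<exists>c::real. c < 3 \<and>
      (\<forall>D :: (real ^ 'n) set. euclidean_domain D \<and> D \<noteq> UNIV \<longrightarrow>
        (\<forall>x\<in>D. \<forall>y\<in>D. gromov_metric D x y \<le> c * distance_ratio_metric D x y)))"
    using distance_ratio_constant_below_3_fails[where 'a = "real ^ 'n"] by (meson not_le)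
qed

end
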